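(* Let $2\le p<\infty$ and $\epsilon<p-1$ be real numbers, and put $$b_0=\exp\left[\frac{\sqrt2\,\pi\,p(p-1)}{p-1-\epsilon}\right].$$ Then there exist positive constants $c_1=c_1(p,\epsilon)$ and $c_2=c_2(p,\epsilon)$, depending only on $p$ and $\epsilon$, such that for all $0<a<b<\infty$ with $b/a>b_0$ the following hold. (i) The smallest constant $d(a,b,p,\epsilon)$ in the finite weighted Hardy inequality on $(a,b)$ satisfies $$\left(\frac{p}{p-1-\epsilon}\right)^p\left(1+\frac{c_1}{\ln^2\frac{b}{a}}\right)^{-1}\le d(a,b,p,\epsilon)\le\left(\frac{p}{p-1-\epsilon}\right)^p\left(1+\frac{c_2}{\ln^2\frac{b}{a}}\right)^{-1}.$$ (ii) Let $\alpha$ be the only solution of the equation $$\tan\left(\alpha\ln\frac{b}{a}\right)+\frac{\alpha p}{p-1-\epsilon}=0$$ in the interval $\left(\frac{\pi}{2\ln\frac ba},\frac{\pi}{\ln\frac ba}\right)$. Then, with the same constant $c_1$, the function $$f^\ast(x)=x^{-(1+\epsilon)/p}\left(\frac{\alpha p}{p-1-\epsilon}\cos\left(\alpha\ln\frac{x}{a}\right)+\sin\left(\alpha\ln\frac{x}{a}\right)\right),\qquad a<x<b,$$ satisfies $$\int_a^b\left(\frac1x\int_a^x f^\ast(t)\,dt\right)^p x^{\epsilon}\,dx\ \ge\ \left(\frac{p}{p-1-\epsilon}\right)^p\left(1+\frac{c_1}{\ln^2\frac ba}\right)^{-1}\int_a^b[f^\ast(x)]^p\,x^{\epsilon}\,d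x.$$
   Context: For $0<a<b<\infty$, $p>1$ and $\epsilon<p-1$, $d(a,b,p,\epsilon)$ denotes the smallest possible constant $d$ such that the finite weighted Hardy inequality $$\int_a^b\left(\frac1x\int_a^x f(t)\,dt\right)^p x^{\epsilon}\,dx\le d\int_a^b [f(x)]^p x^{\epsilon}\,dx$$ holds for all measurable functions $f\ge 0$ on $(a,b)$ such that $f(x)^p x^{\epsilon}$ is integrable over $(a,b)$. Here $\ln^2 y$ means $(\ln y)^2$. *)

theory Defs
  imports "HOL-Analysis.Analysis"
begin

definition hardy_lhs :: "real \<Rightarrow> real \<Rightarrow> real \<Rightarrow> real \<Rightarrow> (real \<Rightarrow> real) \<Rightarrow> real" where
  "hardy_lhs a b p \<epsilon> f =
     (LINT x:{a<..<b}|lebesgue. ((1 / x) * (LINT t:{a<..<x}|lebesgue. f t)) powr p * x powr \<epsilon>)"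

definition hardy_rhs :: "real \<Rightarrow> real \<Rightarrow> real \<Rightarrow> real \<Rightarrow> (real \<Rightarrow> real) \<Rightarrow> real" where
  "hardy_rhs a b p \<epsilon> f = (LINT x:{a<..<b}|lebesgue. f x powr p * x powr \<epsilon>)"

definition hardy_admissible :: "real \<Rightarrow> real \<Rightarrow> real \<Rightarrow> real \<Rightarrow> (real \<Rightarrow> real) \<Rightarrow> bool" where
  "hardy_admissible a b p \<epsilon> f \<longleftrightarrow>
     set_borel_measurable lebesgue {a<..<b} f \<and>
     (\<forall>x\<in>{a<..<b}. 0 \<le> f x) \<and>
     set_integrable lebesgue {a<..<b} (\<lambda>x. f x powr p * x powr \<epsilon>)"

text \<open>For \<open>0 < a < b\<close>, \<open>p > 1\<close> and admissible \<open>f\<close>, Hoelder's inequality makes \<open>f\<close> integrable on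
  \<open>(a, b)\<close>, and the integrand of \<open>hardy_lhs\<close> is then continuous and bounded on \<open>(a, b)\<close>. So all
  Bochner integrals here are integrals of integrable functions; the default value \<open>0\<close> for
  non-integrable functions never arises.\<close>

definition hardy_inequality :: "real \<Rightarrow> real \<Rightarrow> real \<Rightarrow> real \<Rightarrow> real \<Rightarrow> bool" where
  "hardy_inequality a b p \<epsilon> d \<longleftrightarrow>
     (\<forall>f. hardy_admissible a b p \<epsilon> f \<longrightarrow> hardy_lhs a b p \<epsilon> f \<le> d * hardy_rhs a b p \<epsilon> f)"

text \<open>\<open>LEAST\<close> rather than \<open>Inf\<close>: a bound on this constant can only be derived by showing that the
  smallest constant exists.\<close>

definition hardy_constant :: "real \<Rightarrow> real \<Rightarrow> real \<Rightarrow> real \<Rightarrow> real" where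
  "hardy_constant a b p \<epsilon> = (LEAST d. hardy_inequality a b p \<epsilon> d)"

definition hardy_b0 :: "real \<Rightarrow> real \<Rightarrow> real" where
  "hardy_b0 p \<epsilon> = exp (sqrt 2 * pi * p * (p - 1) / (p - 1 - \<epsilon>))"

definition hardy_alpha :: "real \<Rightarrow> real \<Rightarrow> real \<Rightarrow> real \<Rightarrow> real \<Rightarrow> bool" where
  "hardy_alpha a b p \<epsilon> \<alpha> \<longleftrightarrow>
     \<alpha> \<in> {pi / (2 * ln (b / a)) <..< pi / ln (b / a)} \<and>
     tan (\<alpha> * ln (b / a)) + \<alpha> * p / (p - 1 - \<epsilon>) = 0"

definition hardy_fstar :: "real \<Rightarrow> real \<Rightarrow> real \<Rightarrow> real \<Rightarrow> real \<Rightarrow> real" where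
  "hardy_fstar a p \<epsilon> \<alpha> x =
     x powr (- (1 + \<epsilon>) / p) *
     (\<alpha> * p / (p - 1 - \<epsilon>) * cos (\<alpha> * ln (x / a)) + sin (\<alpha> * ln (x / a)))"

end

theory Submission
  imports Defs
begin

text \<open>
  Put \<open>q = (p - 1 - \<epsilon>) / p\<close>, \<open>L = ln (b / a)\<close> and \<open>\<theta> = \<alpha> ln (x / a)\<close>. The primitive of \<open>f\<^sup>*\<close> is
  \<open>x\<^sup>q sin \<theta> / q\<close>, and with \<open>\<phi> = \<pi> - \<alpha> L\<close> the equation for \<open>\<alpha>\<close> says \<open>tan \<phi> = \<alpha> / q\<close>, so that
  \<open>f\<^sup>* = x\<^bsup>q-1\<^esup> sin (\<theta> + \<phi>) / cos \<phi>\<close>. In the variable \<open>\<theta>\<close> the two sides of Hardy's inequality become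
  integrals of \<open>sin\<^sup>p\<close> over \<open>[0, \<pi> - \<phi>]\<close> and \<open>[\<phi>, \<pi>]\<close>, which agree by reflection; hence their ratio is
  exactly \<open>q\<^bsup>-p\<^esup> (1 + (\<alpha> / q)\<^sup>2)\<^bsup>-p/2\<^esup>\<close>, and \<open>\<alpha> < \<pi> / L\<close> gives the lower bound.

  For the upper bound, any positive \<open>u\<close> with primitive \<open>U\<close> yields
  \<open>(\<integral>\<^sub>a\<^sup>x f)\<^sup>p \<le> U\<^bsup>p-1\<^esup> \<integral>\<^sub>a\<^sup>x f\<^sup>p u\<^bsup>1-p\<^esup>\<close>, and Fubini reduces the inequality with constant \<open>D\<close> to
  \<open>- (D x\<^sup>\<epsilon> u\<^bsup>p-1\<^esup>)' \<ge> U\<^bsup>p-1\<^esup> x\<^bsup>\<epsilon>-p\<^esup>\<close>. In terms of \<open>y = x u / (q U)\<close> and \<open>s = ln (x / a)\<close>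
  this is a Riccati inequality, in which \<open>y\<close> may decrease linearly in \<open>s\<close> from \<open>1 + \<eta>\<close> to \<open>1 - \<eta>\<close> with
  \<open>\<eta>\<close> of order \<open>1 / L\<close>; the gain over the sharp constant is then of order \<open>1 / L\<^sup>2\<close>.
\<close>

subsection \<open>A weighted test for Hardy's inequality\<close>

text \<open>A countable Borel cover by sets of finite measure remains one for the completion of
  \<open>lborel\<close>. Exchanging integrals over \<open>lebesgue\<close> requires this.\<close>

lemma sigma_finite_lebesgue: "sigma_finite_measure lebesgue"
proof -
  obtain A :: "'a set set" where A: "countable A" "A \<subseteq> sets lborel" "\<Union>A = space lborel"
      "\<forall>x\<in>A. emeasure lborel x \<noteq> \<infinity>"
    using lborel.sigma_finite_countable by blast
  then show ?thesis
    by (intro sigma_finite_measure.intro exI[of _ A]) (auto simp: subset_eq)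
qed

text \<open>The left side is the tangent at \<open>l\<close> to the convex function
  \<open>r powr p\<close>; the inequality is Young's for \<open>r\<close> and
  \<open>l powr (p - 1)\<close> with exponents \<open>p\<close> and
  \<open>p / (p - 1)\<close>.\<close>

lemma powr_tangent_line:
  fixes r l p :: real
  assumes "1 < p" "0 \<le> r" "0 \<le> l"
  shows "p * l powr (p - 1) * r - (p - 1) * l powr p \<le> r powr p"
proof -
  have e: "(l powr (p - 1)) powr (p / (p - 1)) = l powr p"
    using assms by (simp add: powr_powr)
  have "r * l powr (p - 1) \<le> r powr p / p + (l powr (p - 1)) powr (p / (p - 1)) / (p / (p - 1))"
    by (rule Youngs_inequality) (use assms in \<open>auto simp: field_simps\<close>)
  then show ?thesis
    unfolding e using assms by (simp add: field_simps)
qed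

lemma set_lebesgue_FTC:
  fixes f F :: "real \<Rightarrow> real"
  assumes "a \<le> b"
    and F: "\<And>x. x \<in> {a..b} \<Longrightarrow> (F has_real_derivative f x) (at x)"
    and f: "continuous_on {a..b} f"
  shows "set_integrable lebesgue {a<..<b} f"
    and "(LINT x:{a<..<b}|lebesgue. f x) = F b - F a"
proof -
  have "f absolutely_integrable_on {a..b}"
    by (rule absolutely_integrable_continuous_real[OF f])
  then show i: "set_integrable lebesgue {a<..<b} f"
    by (rule set_integrable_subset) auto
  have "(f has_integral F b - F a) {a..b}"
    using F by (intro fundamental_theorem_of_calculus \<open>a \<le> b\<close>)
      (auto simp: has_real_derivative_iff_has_vector_derivative[symmetric] intro: DERIV_subset)
  then show "(LINT x:{a<..<b}|lebesgue. f x) = F b - F a"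
    using set_lebesgue_integral_eq_integral(2)[OF i]
    by (simp add: integral_open_interval_real[symmetric] integral_unique)
qed

lemma nn_set_integral_FTC:
  fixes f F :: "real \<Rightarrow> real"
  assumes "a \<le> b"
    and F: "\<And>x. x \<in> {a..b} \<Longrightarrow> (F has_real_derivative f x) (at x)"
    and f: "continuous_on {a..b} f"
    and nn: "\<And>x. x \<in> {a..b} \<Longrightarrow> 0 \<le> f x"
  shows "(\<integral>\<^sup>+x\<in>{a<..<b}. ennreal (f x) \<partial>lebesgue) = ennreal (F b - F a)"
proof -
  have "(\<integral>\<^sup>+x\<in>{a<..<b}. ennreal (f x) \<partial>lebesgue) =
      (\<integral>\<^sup>+x. ennreal (indicator {a<..<b} x *\<^sub>R f x) \<partial>lebesgue)"
    by (intro nn_integral_cong) (auto simp: indicator_def)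
  also have "\<dots> = ennreal (\<integral>x. indicator {a<..<b} x *\<^sub>R f x \<partial>lebesgue)"
    using set_lebesgue_FTC(1)[OF assms(1) F f] nn
    by (intro nn_integral_eq_integral) (auto simp: set_integrable_def indicator_def)
  also have "\<dots> = ennreal (F b - F a)"
    using set_lebesgue_FTC(2)[OF assms(1) F f] by (simp add: set_lebesgue_integral_def)
  finally show ?thesis .
qed

text \<open>This is Hoelder's inequality for \<open>f = (f / u) * u\<close>, obtained by multiplying
  the tangent line inequality for \<open>f / u\<close> by \<open>u\<close> and integrating. An upper
  bound \<open>V\<close> stands for the integral of \<open>u\<close>, because later \<open>V\<close>
  is \<open>U x\<close>, which exceeds that integral by \<open>U a\<close>.\<close>

lemma set_lebesgue_integral_powr_le:
  fixes f u :: "real \<Rightarrow> real"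
  assumes p: "1 < p"
    and f: "\<And>t. t \<in> I \<Longrightarrow> 0 \<le> f t"
    and u: "\<And>t. t \<in> I \<Longrightarrow> 0 < u t" "set_integrable lebesgue I u"
    and V: "(LINT t:I|lebesgue. u t) \<le> V" "0 < V"
  shows "ennreal ((LINT t:I|lebesgue. f t) powr p) \<le>
    ennreal (V powr (p - 1)) * (\<integral>\<^sup>+t\<in>I. ennreal (f t powr p * u t powr (1 - p)) \<partial>lebesgue)"
    (is "ennreal (?F powr p) \<le> _ * ?N")
proof (cases "set_integrable lebesgue I f \<and> ?N < \<infinity>")
  case False
  then consider "\<not> set_integrable lebesgue I f" | "?N = \<infinity>"
    by (metis infinity_ennreal_def less_top)
  then show ?thesis
  proof cases
    case 1
    \<comment> \<open>the Bochner integral of a non-integrable function is \<open>0\<close>\<close>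
    then have "?F = 0"
      by (simp add: set_lebesgue_integral_def set_integrable_def not_integrable_integral_eq)
    then show ?thesis by simp
  next
    case 2
    then show ?thesis using V by (simp add: ennreal_mult_top)
  qed
next
  case True
  then obtain N where N: "?N = ennreal N" "0 \<le> N"
    by (cases ?N rule: ennreal_cases) auto
  have F0: "0 \<le> ?F"
    unfolding set_lebesgue_integral_def
    by (intro Bochner_Integration.integral_nonneg) (auto simp: indicator_def f)
  \<comment> \<open>This tangent point maximizes
    \<open>p * l powr (p - 1) * ?F - (p - 1) * l powr p * V\<close>; the maximum is
    \<open>?F powr p / V powr (p - 1)\<close>.\<close>
  define l where "l = ?F / V"
  have l: "0 \<le> l" using F0 V by (simp add: l_def)
  define h where "h t = p * l powr (p - 1) * f t - (p - 1) * l powr p * u t" for t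
  have h: "h t \<le> f t powr p * u t powr (1 - p)" if "t \<in> I" for t
  proof -
    have ut: "0 < u t" using u that by simp
    have "h t = u t * (p * l powr (p - 1) * (f t / u t) - (p - 1) * l powr p)"
      using ut by (simp add: h_def field_simps)
    also have "\<dots> \<le> u t * (f t / u t) powr p"
      using ut l f[OF that] p by (intro mult_left_mono powr_tangent_line) auto
    also have "\<dots> = f t powr p * u t powr (1 - p)"
      using ut f[OF that] by (simp add: powr_divide powr_diff)
    finally show ?thesis .
  qed
  have "(\<integral>\<^sup>+t. ennreal (indicator I t *\<^sub>R h t) \<partial>lebesgue) \<le> ?N"
    by (intro nn_integral_mono) (auto simp: indicator_def intro!: ennreal_leI h)
  then have "(LINT t:I|lebesgue. h t) \<le> N"
    unfolding set_lebesgue_integral_def using N by (intro integral_real_bounded) auto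
  also have "(LINT t:I|lebesgue. h t) =
      p * l powr (p - 1) * ?F - (p - 1) * l powr p * (LINT t:I|lebesgue. u t)"
    unfolding h_def using True u by (subst set_integral_diff) (auto intro: set_integrable_mult_right)
  \<comment> \<open>Replacing the integral of \<open>u\<close> by its upper bound \<open>V\<close>
    cannot raise the left side, since the coefficient \<open>- (p - 1) * l powr p\<close> is at most
    zero.\<close>
  finally have "p * l powr (p - 1) * ?F - (p - 1) * l powr p * V \<le> N"
    by (rule order_trans[rotated]) (use V p in \<open>auto intro!: mult_left_mono\<close>)
  moreover have "p * l powr (p - 1) * ?F - (p - 1) * l powr p * V = ?F powr p / V powr (p - 1)"
  proof (cases "?F = 0")
    case False
    then have F: "0 < ?F" using F0 by simp
    have "l powr (p - 1) * ?F = ?F powr p / V powr (p - 1)"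
      using F V by (simp add: l_def powr_divide powr_diff)
    moreover have "l powr p * V = ?F powr p / V powr (p - 1)"
      using F V by (simp add: l_def powr_divide powr_diff)
    moreover have "p * A - (p - 1) * A = A" for A by (simp add: algebra_simps)
    ultimately show ?thesis by (simp only: mult.assoc)
  qed (simp add: l_def)
  ultimately have "?F powr p / V powr (p - 1) \<le> N" by (simp only:)
  then have "?F powr p \<le> V powr (p - 1) * N"
    using V by (simp add: pos_divide_le_eq mult.commute)
  then show ?thesis
    unfolding N(1) using N(2) by (simp add: ennreal_mult[symmetric] ennreal_leI)
qed

text \<open>After Hoelder with weight \<open>u\<close> and an exchange of integrals,
  \<open>f t powr p * u t powr (1 - p)\<close> is multiplied by the integral of
  \<open>U x powr (p - 1) * x powr (\<epsilon> - p)\<close> over \<open>t < x < b\<close>. The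
  function \<open>g\<close> dominates this integrand and has the primitive \<open>- G\<close>, so
  that integral is at most \<open>G t - G b \<le> G t\<close>, and \<open>Gu\<close> turns this into
  the weight \<open>D * t powr \<epsilon>\<close>.\<close>

lemma weighted_hardy_test:
  fixes U u G g :: "real \<Rightarrow> real"
  assumes a: "0 < a" and p: "1 < p" and D: "0 < D"
    and U: "\<And>x. x \<in> {a..b} \<Longrightarrow> (U has_real_derivative u x) (at x)" "0 < U a"
    and u: "continuous_on {a..b} u" "\<And>x. x \<in> {a..b} \<Longrightarrow> 0 < u x"
    and G: "\<And>x. x \<in> {a..b} \<Longrightarrow> (G has_real_derivative - g x) (at x)" "0 \<le> G b"
    and g: "continuous_on {a..b} g"
      "\<And>x. x \<in> {a..b} \<Longrightarrow> U x powr (p - 1) * x powr (\<epsilon> - p) \<le> g x"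
    and Gu: "\<And>x. x \<in> {a<..<b} \<Longrightarrow> G x \<le> D * x powr \<epsilon> * u x powr (p - 1)"
    and meas [measurable]: "U \<in> borel_measurable borel" "u \<in> borel_measurable borel"
  shows "hardy_inequality a b p \<epsilon> D"
  unfolding hardy_inequality_def
proof (intro allI impI)
  fix f assume f: "hardy_admissible a b p \<epsilon> f"
  define F where "F x = (LINT t:{a<..<x}|lebesgue. f t)" for x
  define J where "J = {a<..<b}"
  define k where "k x = U x powr (p - 1) * x powr (\<epsilon> - p)" for x
  have fnn: "0 \<le> f x" if "x \<in> J" for x
    using f that by (auto simp: hardy_admissible_def J_def)
  have fint: "set_integrable lebesgue J (\<lambda>x. f x powr p * x powr \<epsilon>)"
    using f by (auto simp: hardy_admissible_def J_def)
  \<comment> \<open>Admissibility gives measurability only on \<open>J\<close>; the extension by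
    zero is measurable on the whole line.\<close>
  define f0 where "f0 t = indicator J t *\<^sub>R f t" for t
  have [measurable]: "f0 \<in> borel_measurable lebesgue"
    using f by (simp add: hardy_admissible_def set_borel_measurable_def J_def f0_def[abs_def])
  have R0: "0 \<le> hardy_rhs a b p \<epsilon> f"
    unfolding hardy_rhs_def set_lebesgue_integral_def
    by (intro Bochner_Integration.integral_nonneg) (auto simp: indicator_def)
  define \<phi> where "\<phi> t = ennreal (f0 t powr p * u t powr (1 - p)) * indicator J t" for t
  have [measurable]: "u \<in> borel_measurable lebesgue" "U \<in> borel_measurable lebesgue"
    using meas by (simp_all add: measurable_completion)
  have [measurable]: "(\<lambda>x. x) \<in> borel_measurable lebesgue"
    by (simp add: measurable_completion)
  have [measurable]: "J \<in> sets lebesgue" "J \<in> sets borel" by (simp_all add: J_def)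
  have [measurable]: "\<phi> \<in> borel_measurable lebesgue"
    unfolding \<phi>_def by measurable
  have [measurable]: "k \<in> borel_measurable lebesgue"
    unfolding k_def[abs_def] by measurable
  have G': "((\<lambda>x. - G x) has_real_derivative g x) (at x)" if "x \<in> {a..b}" for x
    using DERIV_minus[OF G(1)[OF that]] by simp
  \<comment> \<open>The condition \<open>t < x\<close> is kept as an indicator inside an integral
    over the whole line, so that the domain of integration does not depend on \<open>x\<close> when
    the order is exchanged.\<close>
  have pointwise: "ennreal ((1 / x * F x) powr p * x powr \<epsilon>) \<le>
      (\<integral>\<^sup>+t. ennreal (k x) * \<phi> t * indicator {t<..} x \<partial>lebesgue)" if x: "x \<in> J" for x
  proof -
    have ax: "a < x" "x < b" using x by (auto simp: J_def)
    have ui: "set_integrable lebesgue {a<..<x} u" "(LINT t:{a<..<x}|lebesgue. u t) = U x - U a"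
      using ax U by (auto intro!: set_lebesgue_FTC[where F = U] continuous_on_subset[OF u(1)])
    have Ux: "0 < U x"
    proof -
      have "0 \<le> (LINT t:{a<..<x}|lebesgue. u t)"
        unfolding set_lebesgue_integral_def using ax u(2)
        by (intro Bochner_Integration.integral_nonneg) (auto simp: indicator_def less_imp_le)
      then show ?thesis using ui(2) U(2) by simp
    qed
    have "ennreal (F x powr p) \<le> ennreal (U x powr (p - 1)) *
        (\<integral>\<^sup>+t\<in>{a<..<x}. ennreal (f t powr p * u t powr (1 - p)) \<partial>lebesgue)"
      unfolding F_def using ax p ui Ux U(2) u(2)
      by (intro set_lebesgue_integral_powr_le fnn) (auto simp: J_def)
    also have "(\<integral>\<^sup>+t\<in>{a<..<x}. ennreal (f t powr p * u t powr (1 - p)) \<partial>lebesgue) =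
        (\<integral>\<^sup>+t. \<phi> t * indicator {t<..} x \<partial>lebesgue)"
      using ax by (intro nn_integral_cong) (auto simp: \<phi>_def f0_def J_def indicator_def)
    finally have 1: "ennreal (F x powr p) \<le>
      ennreal (U x powr (p - 1)) * (\<integral>\<^sup>+t. \<phi> t * indicator {t<..} x \<partial>lebesgue)" .
    have F0: "0 \<le> F x"
      unfolding F_def set_lebesgue_integral_def using ax
      by (intro Bochner_Integration.integral_nonneg) (auto simp: indicator_def J_def intro!: fnn)
    have "(1 / x * F x) powr p * x powr \<epsilon> = F x powr p * x powr (\<epsilon> - p)"
      using F0 ax a by (simp add: powr_divide powr_diff)
    then have "ennreal ((1 / x * F x) powr p * x powr \<epsilon>) = ennreal (x powr (\<epsilon> - p)) * ennreal (F x powr p)"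
      by (simp add: ennreal_mult mult.commute)
    also have "\<dots> \<le> ennreal (x powr (\<epsilon> - p)) *
      (ennreal (U x powr (p - 1)) * (\<integral>\<^sup>+t. \<phi> t * indicator {t<..} x \<partial>lebesgue))"
      by (intro mult_left_mono 1) simp
    also have "\<dots> = ennreal (k x) * (\<integral>\<^sup>+t. \<phi> t * indicator {t<..} x \<partial>lebesgue)"
      by (simp add: k_def ennreal_mult ac_simps)
    also have "\<dots> = (\<integral>\<^sup>+t. ennreal (k x) * (\<phi> t * indicator {t<..} x) \<partial>lebesgue)"
    proof (rule nn_integral_cmult[symmetric])
      have "(\<lambda>t. \<phi> t * indicator {..<x} t) \<in> borel_measurable lebesgue"
        by measurable
      then show "(\<lambda>t. \<phi> t * indicator {t<..} x) \<in> borel_measurable lebesgue"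
        by (simp add: indicator_def)
    qed
    finally show ?thesis by (simp add: ac_simps)
  qed
  have inner: "(\<integral>\<^sup>+x\<in>J. ennreal (k x) * \<phi> t * indicator {t<..} x \<partial>lebesgue) \<le>
      ennreal D * ennreal (indicator J t *\<^sub>R (f t powr p * t powr \<epsilon>))" for t
  proof (cases "t \<in> J")
    case True
    then have t: "a < t" "t < b" by (auto simp: J_def)
    have "(\<integral>\<^sup>+x\<in>J. ennreal (k x) * \<phi> t * indicator {t<..} x \<partial>lebesgue) \<le>
        (\<integral>\<^sup>+x. \<phi> t * (ennreal (g x) * indicator {t<..<b} x) \<partial>lebesgue)"
      using t g(2) by (intro nn_integral_mono)
       (auto simp: J_def indicator_def k_def mult.commute intro!: mult_left_mono ennreal_leI)
    also have "\<dots> = \<phi> t * (\<integral>\<^sup>+x\<in>{t<..<b}. ennreal (g x) \<partial>lebesgue)"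
    proof (rule nn_integral_cmult)
      have "set_integrable lebesgue {t<..<b} g"
        using t by (intro set_lebesgue_FTC(1)[OF _ G'])
          (auto intro!: continuous_on_subset[OF g(1)])
      then have "(\<lambda>x. ennreal (indicator {t<..<b} x *\<^sub>R g x)) \<in> borel_measurable lebesgue"
        by (auto simp: set_integrable_def)
      also have "(\<lambda>x. ennreal (indicator {t<..<b} x *\<^sub>R g x)) = (\<lambda>x. ennreal (g x) * indicator {t<..<b} x)"
        by (auto simp: indicator_def)
      finally show "(\<lambda>x. ennreal (g x) * indicator {t<..<b} x) \<in> borel_measurable lebesgue" .
    qed
    also have "(\<integral>\<^sup>+x\<in>{t<..<b}. ennreal (g x) \<partial>lebesgue) = ennreal (- G b - (- G t))"
    proof (rule nn_set_integral_FTC[OF _ G'])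
      show "0 \<le> g x" if "x \<in> {t..b}" for x
        using g(2)[of x] that t by (intro order_trans[OF _ g(2)]) auto
    qed (use t in \<open>auto intro!: continuous_on_subset[OF g(1)]\<close>)
    also have "\<dots> \<le> ennreal (D * t powr \<epsilon> * u t powr (p - 1))"
      using G(2) Gu[of t] t by (intro ennreal_leI) auto
    also have "\<phi> t * \<dots> = ennreal D * ennreal (indicator J t *\<^sub>R (f t powr p * t powr \<epsilon>))"
      using True t D u(2)[of t]
      by (simp add: \<phi>_def f0_def ennreal_mult[symmetric] powr_diff field_simps)
    finally show ?thesis by (simp add: mult_left_mono)
  qed (simp add: \<phi>_def)
  have "(\<integral>\<^sup>+x\<in>J. ennreal ((1 / x * F x) powr p * x powr \<epsilon>) \<partial>lebesgue) \<le>
      (\<integral>\<^sup>+x. (\<integral>\<^sup>+t. ennreal (k x) * \<phi> t * indicator {t<..} x * indicator J x \<partial>lebesgue) \<partial>lebesgue)"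
    by (intro nn_integral_mono) (use pointwise in \<open>auto simp: indicator_def[of J]\<close>)
  also have "\<dots> = (\<integral>\<^sup>+t. (\<integral>\<^sup>+x. ennreal (k x) * \<phi> t * indicator {t<..} x * indicator J x \<partial>lebesgue) \<partial>lebesgue)"
  proof -
    interpret pair_sigma_finite "lebesgue :: real measure" "lebesgue :: real measure"
      by (intro pair_sigma_finite.intro sigma_finite_lebesgue)
    \<comment> \<open>As a condition on the pair, \<open>t < x\<close> is visibly jointly
      measurable, which Tonelli's theorem needs.\<close>
    have i: "indicator {t<..} x = (if t < x then 1 else 0 :: ennreal)" for t x :: real
      by (simp add: indicator_def)
    show ?thesis
      unfolding i by (rule Fubini') measurable
  qed
  also have "\<dots> \<le> (\<integral>\<^sup>+t. ennreal D * ennreal (indicator J t *\<^sub>R (f t powr p * t powr \<epsilon>)) \<partial>lebesgue)"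
    by (intro nn_integral_mono inner)
  also have "\<dots> = ennreal D * (\<integral>\<^sup>+t. ennreal (indicator J t *\<^sub>R (f t powr p * t powr \<epsilon>)) \<partial>lebesgue)"
    using fint by (intro nn_integral_cmult) (auto simp: set_integrable_def)
  also have "(\<integral>\<^sup>+t. ennreal (indicator J t *\<^sub>R (f t powr p * t powr \<epsilon>)) \<partial>lebesgue) = ennreal (hardy_rhs a b p \<epsilon> f)"
    using fint unfolding hardy_rhs_def J_def[symmetric] set_lebesgue_integral_def
    by (intro nn_integral_eq_integral) (auto simp: set_integrable_def)
  finally have "(\<integral>\<^sup>+x. ennreal (indicator J x *\<^sub>R ((1 / x * F x) powr p * x powr \<epsilon>)) \<partial>lebesgue) \<le>
      ennreal (D * hardy_rhs a b p \<epsilon> f)"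
    using D R0 by (simp add: ennreal_mult ennreal_indicator mult.commute)
  then show "hardy_lhs a b p \<epsilon> f \<le> D * hardy_rhs a b p \<epsilon> f"
    unfolding hardy_lhs_def J_def[symmetric] F_def[symmetric]
    unfolding set_lebesgue_integral_def
    using D R0 by (intro integral_real_bounded) auto
qed

subsection \<open>A test function with linear logarithmic profile\<close>

text \<open>Call the left side \<open>H y\<close>. Then \<open>H 1 = 0\<close> and its derivative
  carries a factor \<open>z - 1\<close>, so the mean value inequality between \<open>1\<close> and
  \<open>y\<close> gives a bound quadratic in \<open>y - 1\<close>. This is the loss when the
  profile of the test function leaves the value \<open>1\<close>.\<close>

lemma one_minus_powr_convex_defect:
  fixes p y :: real
  assumes p: "2 \<le> p" and y: "1 / 2 \<le> y" "y \<le> 3 / 2"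
  shows "1 - p * y powr (p - 1) + (p - 1) * y powr p \<le> p * (p - 1) * 2 powr p * (y - 1)\<^sup>2"
proof -
  define H where "H z = 1 - p * z powr (p - 1) + (p - 1) * z powr p" for z :: real
  define H' where "H' z = p * (p - 1) * z powr (p - 2) * (z - 1)" for z :: real
  have H: "(H has_field_derivative H' z) (at z within S)" if "0 < z" for z S
  proof -
    have "z powr (p - 1) = z powr (p - 2) * z"
      using that powr_add[of z "p - 2" 1] by simp
    then show ?thesis
      unfolding H_def H'_def using that
      by (auto intro!: derivative_eq_intros simp: algebra_simps)
  qed
  have H'_le: "\<bar>H' z\<bar> \<le> p * (p - 1) * 2 powr p * \<bar>y - 1\<bar>" if z: "z \<in> closed_segment 1 y" for z
  proof -
    have zz: "\<bar>z - 1\<bar> \<le> \<bar>y - 1\<bar>" "1 / 2 \<le> z" "z \<le> 3 / 2"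
      using z y by (auto simp: closed_segment_eq_real_ivl split: if_splits)
    have "z powr (p - 2) \<le> 2 powr (p - 2)"
      using zz p by (intro powr_mono2) auto
    also have "\<dots> \<le> 2 powr p" by (intro powr_mono) auto
    finally have "z powr (p - 2) * \<bar>z - 1\<bar> \<le> 2 powr p * \<bar>y - 1\<bar>"
      using zz by (intro mult_mono) auto
    then have "p * (p - 1) * (z powr (p - 2) * \<bar>z - 1\<bar>) \<le> p * (p - 1) * (2 powr p * \<bar>y - 1\<bar>)"
      using p by (intro mult_left_mono) auto
    then show ?thesis
      using p by (simp add: H'_def abs_mult mult.assoc)
  qed
  have "norm (H y - H 1) \<le> p * (p - 1) * 2 powr p * \<bar>y - 1\<bar> * norm (y - 1)"
    by (rule field_differentiable_bound[where S = "closed_segment 1 y"])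
      (use y H'_le in \<open>auto intro!: H simp: closed_segment_eq_real_ivl split: if_splits\<close>)
  moreover have "H 1 = 0" by (simp add: H_def)
  ultimately show ?thesis
    by (simp add: H_def power2_eq_square mult.assoc)
qed

text \<open>Here \<open>y = x * u / (q * U)\<close> falls linearly in \<open>ln (x / a)\<close> from
  \<open>1 + \<eta>\<close> to \<open>1 - \<eta>\<close>. Compared with \<open>y = 1\<close>, the
  deviation costs at most the term in \<open>\<eta>\<^sup>2\<close>, while the negative slope gains
  at least the right side of \<open>profile\<close>; that hypothesis says that a surplus
  \<open>\<kappa>\<close> remains.\<close>

lemma hardy_inequality_linear_profile:
  fixes a b p \<epsilon> q \<eta> \<kappa> :: real
  assumes ab: "0 < a" "a < b" and p: "2 \<le> p" and \<epsilon>: "\<epsilon> < p - 1"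
    and q_def: "q = (p - 1 - \<epsilon>) / p"
    and \<eta>: "0 < \<eta>" "\<eta> \<le> 1 / 2" and \<kappa>: "0 \<le> \<kappa>"
    and profile: "\<kappa> + p * (p - 1) * 2 powr p * \<eta>\<^sup>2 \<le>
      2 * \<eta> / ln (b / a) * ((p - 1) / q * (1 / 2) powr (p - 2))"
  shows "hardy_inequality a b p \<epsilon> (inverse (q powr p * (1 + \<kappa>)))"
proof -
  define L where "L = ln (b / a)"
  define D where "D = inverse (q powr p * (1 + \<kappa>))"
  have q: "0 < q" using p \<epsilon> by (simp add: q_def)
  have \<epsilon>_eq: "\<epsilon> = p - 1 - p * q" using p by (simp add: q_def)
  have L: "0 < L" using ab by (simp add: L_def)
  have D: "0 < D" using q \<kappa> by (simp add: D_def)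
  have "q powr p * (1 + \<kappa>) \<noteq> 0" using q \<kappa> by simp
  then have Dq: "D * q powr p * (1 + \<kappa>) = 1" unfolding D_def mult.assoc by (rule left_inverse)
  define s where "s x = ln x - ln a" for x
  define y where "y x = 1 + \<eta> - 2 * \<eta> * s x / L" for x
  \<comment> \<open>This solves \<open>x * w' / w = q * (y - 1)\<close> with \<open>w a = 1\<close>,
    so that \<open>x * U' / U = q * y\<close>.\<close>
  define w where "w x = exp (q * \<eta> * (s x - (s x)\<^sup>2 / L))" for x
  define U where "U x = x powr q * w x" for x
  define u where "u x = x powr (q - 1) * (q * y x * w x)" for x
  \<comment> \<open>On the interval this equals
    \<open>D * x powr \<epsilon> * u x powr (p - 1)\<close>, since
    \<open>\<epsilon> + (q - 1) * (p - 1) = - q\<close>.\<close>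
  define G where "G x = D * x powr (- q) * (q * y x * w x) powr (p - 1)" for x
  \<comment> \<open>The bracket is \<open>- x * G' / G\<close>, read off from the logarithmic
    derivatives of \<open>x powr (- q)\<close>, \<open>y\<close> and \<open>w\<close>.\<close>
  define g where "g x = G x / x * (p * q - (p - 1) * q * y x + (p - 1) * (2 * \<eta> / L) / y x)" for x
  have s: "0 \<le> s x" "s x \<le> L" if "x \<in> {a..b}" for x
    using that ab by (auto simp: s_def L_def ln_div)
  have y: "1 / 2 \<le> y x" "y x \<le> 3 / 2" "\<bar>y x - 1\<bar> \<le> \<eta>" if "x \<in> {a..b}" for x
  proof -
    have "0 \<le> s x / L" "s x / L \<le> 1" using s[OF that] L by auto
    then have "0 \<le> \<eta> * (s x / L)" "\<eta> * (s x / L) \<le> \<eta> * 1"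
      using \<eta> by (auto intro!: mult_nonneg_nonneg mult_left_mono simp del: times_divide_eq_right)
    then show "1 / 2 \<le> y x" "y x \<le> 3 / 2" "\<bar>y x - 1\<bar> \<le> \<eta>"
      using \<eta> by (auto simp: y_def)
  qed
  have xpos: "0 < x" if "x \<in> {a..b}" for x using that ab by auto
  have s': "(s has_real_derivative 1 / x) (at x)" if "x \<in> {a..b}" for x
    unfolding s_def using xpos[OF that] by (auto intro!: derivative_eq_intros)
  have y': "(y has_real_derivative - (2 * \<eta> / L) / x) (at x)" if "x \<in> {a..b}" for x
    unfolding y_def using xpos[OF that] L
    by (auto intro!: derivative_eq_intros s'[OF that] simp: field_simps)
  have w': "(w has_real_derivative q * (y x - 1) * w x / x) (at x)" if "x \<in> {a..b}" for x
    unfolding w_def y_def using xpos[OF that] L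
    by (auto intro!: derivative_eq_intros s'[OF that] simp: field_simps)
  have U': "(U has_real_derivative u x) (at x)" if "x \<in> {a..b}" for x
    unfolding U_def u_def using xpos[OF that]
    by (auto intro!: derivative_eq_intros w'[OF that] simp: powr_diff field_simps)
  have G': "(G has_real_derivative - g x) (at x)" if x: "x \<in> {a..b}" for x
  proof -
    define v where "v x = q * y x * w x" for x
    have v: "0 < v x" using q y[OF x] by (simp add: v_def w_def)
    have v': "(v has_real_derivative v x * (- (2 * \<eta> / L) / y x + q * (y x - 1)) / x) (at x)"
      unfolding v_def using xpos[OF x] L y[OF x]
      by (auto intro!: derivative_eq_intros w'[OF x] y'[OF x] simp: field_simps power2_eq_square)
    have e: "v x powr (p - 1 - 1) = v x powr (p - 1) / v x"
      "x powr (- q - 1) = x powr (- q) / x"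
      using v xpos[OF x] by (simp_all add: powr_diff power2_eq_square)
    have "((\<lambda>x. D * x powr (- q) * v x powr (p - 1)) has_real_derivative
      D * (- q * x powr (- q - 1)) * v x powr (p - 1) +
      D * x powr (- q) * ((p - 1) * v x powr (p - 1 - 1) *
        (v x * (- (2 * \<eta> / L) / y x + q * (y x - 1)) / x))) (at x)"
      using xpos[OF x] v by (auto intro!: derivative_eq_intros v')
    also have "D * (- q * x powr (- q - 1)) * v x powr (p - 1) +
      D * x powr (- q) * ((p - 1) * v x powr (p - 1 - 1) *
        (v x * (- (2 * \<eta> / L) / y x + q * (y x - 1)) / x)) =
      D * x powr (- q) * v x powr (p - 1) / x * (- q + (p - 1) * (- (2 * \<eta> / L) / y x + q * (y x - 1)))"
      unfolding e using v xpos[OF x] by (simp add: field_simps power2_eq_square)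
    also have "\<dots> = - g x"
      unfolding g_def G_def v_def[symmetric] minus_mult_right
      by (rule arg_cong2[where f = "(*)"]) (auto simp: algebra_simps)
    finally show ?thesis
      unfolding G_def v_def .
  qed
  have cont: "continuous_on {a..b} w" "continuous_on {a..b} y" "continuous_on {a..b} G"
    by (rule DERIV_continuous_on, rule has_field_derivative_at_within,
      rule w' y' G', assumption)+
  have "hardy_inequality a b p \<epsilon> D"
  proof (rule weighted_hardy_test[where U = U and u = u and G = G and g = g])
    show "continuous_on {a..b} u"
      unfolding u_def using ab by (intro continuous_intros cont) auto
    show "continuous_on {a..b} g"
      unfolding g_def using ab L y(1) by (intro continuous_intros cont) (auto, force)
    show "0 < u x" if "x \<in> {a..b}" for x
      using q y[OF that] xpos[OF that] by (simp add: u_def w_def)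
    show "0 < U a" using ab by (simp add: U_def w_def)
    show "0 \<le> G b" using D by (simp add: G_def)
    show "U \<in> borel_measurable borel" "u \<in> borel_measurable borel"
      unfolding U_def[abs_def] u_def[abs_def] w_def y_def s_def by measurable
    show "G x \<le> D * x powr \<epsilon> * u x powr (p - 1)" if "x \<in> {a<..<b}" for x
    proof -
      have x: "x \<in> {a..b}" using that by auto
      have "u x powr (p - 1) = x powr ((q - 1) * (p - 1)) * (q * y x * w x) powr (p - 1)"
        unfolding u_def using q y[OF x] xpos[OF x]
        by (simp add: powr_mult powr_powr w_def)
      moreover have "x powr \<epsilon> * x powr ((q - 1) * (p - 1)) = x powr (- q)"
        unfolding powr_add[symmetric] by (simp add: \<epsilon>_eq algebra_simps)
      ultimately have "D * x powr \<epsilon> * u x powr (p - 1) = G x"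
        unfolding G_def by (metis mult.assoc)
      then show ?thesis by simp
    qed
    show "U x powr (p - 1) * x powr (\<epsilon> - p) \<le> g x" if x: "x \<in> {a..b}" for x
    proof -
      note yx = y[OF x]
      have "U x powr (p - 1) * x powr (\<epsilon> - p) = x powr (q * (p - 1)) * x powr (\<epsilon> - p) * w x powr (p - 1)"
        using xpos[OF x] by (simp add: U_def powr_mult powr_powr w_def)
      also have "x powr (q * (p - 1)) * x powr (\<epsilon> - p) = x powr (- q - 1)"
        unfolding powr_add[symmetric] by (rule arg_cong[where f = "(powr) x"]) (simp add: \<epsilon>_eq algebra_simps)
      also have "\<dots> = x powr (- q) / x"
        using xpos[OF x] by (simp add: powr_diff)
      finally have lhs: "U x powr (p - 1) * x powr (\<epsilon> - p) = x powr (- q) / x * w x powr (p - 1)" .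
      have yp: "y x powr p = y x powr (p - 1) * y x" "y x powr (p - 1) = y x powr (p - 2) * y x"
        using yx powr_add[of "y x" "p - 1" 1] powr_add[of "y x" "p - 2" 1] by simp_all
      have qp: "q powr p = q powr (p - 1) * q"
        using q powr_add[of q "p - 1" 1] by simp
      \<comment> \<open>The factor \<open>x powr (- q) / x * w x powr (p - 1)\<close> is common to
        both sides; splitting it off leaves a Riccati inequality in \<open>y x\<close>
        alone.\<close>
      have "g x = x powr (- q) / x * w x powr (p - 1) * (D * q powr p *
        (y x powr (p - 1) * (p - (p - 1) * y x + (p - 1) * (2 * \<eta> / L) / (q * y x))))"
        unfolding g_def G_def using q yx xpos[OF x] L
        by (simp add: powr_mult w_def qp field_simps)
      also have "y x powr (p - 1) * (p - (p - 1) * y x + (p - 1) * (2 * \<eta> / L) / (q * y x)) =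
        p * y x powr (p - 1) - (p - 1) * y x powr p + 2 * \<eta> / L * ((p - 1) / q * y x powr (p - 2))"
        unfolding yp(1) using q yx L by (simp add: yp(2) field_simps)
      finally have gx: "g x = x powr (- q) / x * w x powr (p - 1) * (D * q powr p *
        (p * y x powr (p - 1) - (p - 1) * y x powr p + 2 * \<eta> / L * ((p - 1) / q * y x powr (p - 2))))" .
      have "1 - p * y x powr (p - 1) + (p - 1) * y x powr p \<le> p * (p - 1) * 2 powr p * (y x - 1)\<^sup>2"
        by (rule one_minus_powr_convex_defect) (use p yx in auto)
      also have "\<dots> \<le> p * (p - 1) * 2 powr p * \<eta>\<^sup>2"
        using yx \<eta> p by (intro mult_left_mono) (auto simp: abs_le_square_iff[symmetric])
      also have "\<dots> \<le> 2 * \<eta> / L * ((p - 1) / q * (1 / 2) powr (p - 2)) - \<kappa>"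
        using profile by (simp add: L_def)
      \<comment> \<open>Since \<open>p - 2 \<ge> 0\<close>, the power
        \<open>y x powr (p - 2)\<close> is at least its value at the lower bound
        \<open>1 / 2\<close>.\<close>
      also have "\<dots> \<le> 2 * \<eta> / L * ((p - 1) / q * y x powr (p - 2)) - \<kappa>"
        using yx p q \<eta> L by (intro diff_right_mono mult_left_mono powr_mono2) auto
      finally have "1 + \<kappa> \<le> p * y x powr (p - 1) - (p - 1) * y x powr p +
          2 * \<eta> / L * ((p - 1) / q * y x powr (p - 2))"
        by simp
      then have "D * q powr p * (1 + \<kappa>) \<le> D * q powr p *
        (p * y x powr (p - 1) - (p - 1) * y x powr p + 2 * \<eta> / L * ((p - 1) / q * y x powr (p - 2)))"
        using D by (intro mult_left_mono) auto
      then have "x powr (- q) / x * w x powr (p - 1) * 1 \<le> g x"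
        unfolding gx Dq using xpos[OF x] by (intro mult_left_mono) auto
      then show ?thesis by (simp add: lhs)
    qed
  qed (use ab p D U' G' in auto)
  then show ?thesis by (simp add: D_def)
qed

subsection \<open>The extremal function\<close>

text \<open>Existence follows from the intermediate value theorem after clearing the cosine, which
  vanishes at the left endpoint. Uniqueness holds because the tangent, shifted by its period into
  the interval from \<open>- pi / 2\<close> to \<open>0\<close>, is strictly increasing, and so is
  the linear term.\<close>

lemma tan_add_linear_ex1:
  fixes L c :: real
  assumes L: "0 < L" and c: "0 < c"
  shows "\<exists>!\<alpha>. \<alpha> \<in> {pi / (2 * L) <..< pi / L} \<and> tan (\<alpha> * L) + \<alpha> * c = 0"
proof (rule ex_ex1I)
  define h where "h x = sin (x * L) + x * c * cos (x * L)" for x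
  have "\<exists>x. pi / (2 * L) \<le> x \<and> x \<le> pi / L \<and> h x = 0"
    by (rule IVT2') (use L c in \<open>auto simp: h_def field_simps intro!: continuous_intros\<close>)
  then obtain x where x: "pi / (2 * L) \<le> x" "x \<le> pi / L" "h x = 0" by blast
  have "h (pi / (2 * L)) = 1" "h (pi / L) < 0"
    using L c by (auto simp: h_def)
  with x have x': "pi / (2 * L) < x" "x < pi / L"
    by (auto simp: less_le)
  then have "cos (x * L) < 0"
    using L cos_gt_zero_pi[of "x * L - pi"] by (simp add: field_simps cos_diff)
  then have "tan (x * L) + x * c = 0"
    using x(3) by (simp add: h_def tan_def field_simps)
  with x' show "\<exists>\<alpha>. \<alpha> \<in> {pi / (2 * L) <..< pi / L} \<and> tan (\<alpha> * L) + \<alpha> * c = 0" by auto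
next
  have less: "tan (x * L) + x * c < tan (y * L) + y * c"
    if "x \<in> {pi / (2 * L) <..< pi / L}" "y \<in> {pi / (2 * L) <..< pi / L}" "x < y" for x y
  proof -
    have "tan (x * L - pi) < tan (y * L - pi)"
      using that L by (intro tan_monotone) (auto simp: field_simps)
    moreover have "tan (z - pi) = tan z" for z :: real
      using tan_periodic_pi[of "z - pi"] by simp
    ultimately show ?thesis using that c by (simp add: add_strict_mono)
  qed
  fix x y
  assume "x \<in> {pi / (2 * L) <..< pi / L} \<and> tan (x * L) + x * c = 0"
    and "y \<in> {pi / (2 * L) <..< pi / L} \<and> tan (y * L) + y * c = 0"
  then show "x = y"
    using less[of x y] less[of y x] by (cases x y rule: linorder_cases) auto
qed

text \<open>\<open>S\<close> replaces a closed form for the integral of \<open>sin t powr p\<close>.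
  The symmetry \<open>sin (pi - t) = sin t\<close> equates the integrals over \<open>[t, pi]\<close>
  and \<open>[0, pi - t]\<close>, which later identifies the two sides of Hardy's inequality up to
  constants; strict growth keeps them positive.\<close>

lemma sin_powr_antiderivative:
  fixes p :: real
  assumes "0 < p"
  obtains S where "\<And>t. \<lbrakk>0 \<le> t; t \<le> pi\<rbrakk> \<Longrightarrow> (S has_real_derivative sin t powr p) (at t)"
    and "\<And>t. \<lbrakk>0 \<le> t; t \<le> pi\<rbrakk> \<Longrightarrow> S pi - S t = S (pi - t) - S 0"
    and "strict_mono_on {0..pi} S"
proof -
  \<comment> \<open>an interval with \<open>[0, \<pi>]\<close> in its interior, so that the derivatives at \<open>0\<close> and \<open>\<pi>\<close> are two-sided\<close>
  have "continuous_on {-1..4} (\<lambda>t. \<bar>sin t\<bar> powr p)"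
    using assms by (intro continuous_on_powr' continuous_intros) auto
  then obtain S where S: "\<And>t. t \<in> {-1..4} \<Longrightarrow>
      (S has_vector_derivative \<bar>sin t\<bar> powr p) (at t within {-1..4})"
    by (rule antiderivative_continuous) blast
  have S': "(S has_real_derivative sin t powr p) (at t)" if t: "0 \<le> t" "t \<le> pi" for t
  proof -
    have "pi < 4" using pi_less_4 .
    with t have "t \<in> {-1<..<4}" by auto
    moreover have "interior {-1..4} = {-1<..<4::real}" by simp
    ultimately have "(S has_real_derivative \<bar>sin t\<bar> powr p) (at t)"
      using S[of t] at_within_interior[of t "{-1..4}"]
      by (auto simp: has_real_derivative_iff_has_vector_derivative)
    then show ?thesis using sin_ge_zero[OF t] by simp
  qed
  have cont: "continuous_on {0..pi} S"
    by (rule DERIV_continuous_on, rule has_field_derivative_at_within, rule S') auto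
  show thesis
  proof (rule that[of S])
    show "strict_mono_on {0..pi} S"
    proof (rule strict_mono_onI)
      fix x y assume xy: "x \<in> {0..pi}" "y \<in> {0..pi}" "x < y"
      show "S x < S y"
      proof (rule DERIV_pos_imp_increasing_open[OF \<open>x < y\<close>])
        show "\<exists>d. (S has_real_derivative d) (at t) \<and> 0 < d" if "x < t" "t < y" for t
          using that xy S'[of t] sin_gt_zero[of t] by (intro exI[of _ "sin t powr p"]) auto
        show "continuous_on {x..y} S"
          using xy by (intro continuous_on_subset[OF cont]) auto
      qed
    qed
    show "S pi - S t = S (pi - t) - S 0" if t: "0 \<le> t" "t \<le> pi" for t
    proof (cases "t = 0")
      case False
      \<comment> \<open>As a function of \<open>t\<close> the left side has derivative
        \<open>sin t powr p - sin (pi - t) powr p = 0\<close>.\<close>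
      have "S (pi - t) + S t = S (pi - 0) + S 0"
      proof (rule DERIV_isconst2[of 0 pi])
        show "continuous_on {0..pi} (\<lambda>t. S (pi - t) + S t)"
          by (intro continuous_intros cont continuous_on_compose2[OF cont]) auto
        show "((\<lambda>t. S (pi - t) + S t) has_real_derivative 0) (at x)" if "0 < x" "x < pi" for x
          using that by (auto intro!: derivative_eq_intros DERIV_chain2[OF S'] S')
      qed (use t False in auto)
      then show ?thesis by simp
    qed simp
  qed (rule S')
qed

text \<open>Both sides reduce to integrals of a power of the sine over reflected intervals, so the
  quotient is known exactly. The factor \<open>(1 + (\<alpha> / q)\<^sup>2) powr (p / 2)\<close> is
  \<open>cos \<phi> powr (- p)\<close> for the angle with
  \<open>tan \<phi> = \<alpha> / q\<close>.\<close>

lemma hardy_fstar_extremal: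
  fixes a b p \<epsilon> \<alpha> q :: real
  assumes ab: "0 < a" "a < b" and p: "1 < p" and \<epsilon>: "\<epsilon> < p - 1"
    and q_def: "q = (p - 1 - \<epsilon>) / p"
    and \<alpha>: "hardy_alpha a b p \<epsilon> \<alpha>"
  shows "hardy_admissible a b p \<epsilon> (hardy_fstar a p \<epsilon> \<alpha>)"
    and "0 < hardy_rhs a b p \<epsilon> (hardy_fstar a p \<epsilon> \<alpha>)"
    and "q powr p * (1 + (\<alpha> / q)\<^sup>2) powr (p / 2) * hardy_lhs a b p \<epsilon> (hardy_fstar a p \<epsilon> \<alpha>) =
      hardy_rhs a b p \<epsilon> (hardy_fstar a p \<epsilon> \<alpha>)"
proof -
  define L where "L = ln (b / a)"
  define \<theta> where "\<theta> x = \<alpha> * ln (x / a)" for x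
  \<comment> \<open>\<open>\<alpha> * L\<close> lies in the second quadrant, so
    \<open>\<phi>\<close> lies strictly between \<open>0\<close> and \<open>pi / 2\<close> and has
    positive cosine. The phase \<open>\<theta> x + \<phi>\<close> runs from \<open>\<phi>\<close> to
    \<open>pi\<close>, where the sine is nonnegative.\<close>
  define \<phi> where "\<phi> = pi - \<alpha> * L"
  define f where "f = hardy_fstar a p \<epsilon> \<alpha>"
  have q: "0 < q" using p \<epsilon> by (simp add: q_def)
  have \<epsilon>_eq: "\<epsilon> = p - 1 - p * q" using p by (simp add: q_def)
  have L: "0 < L" using ab by (simp add: L_def)
  have \<alpha>L: "pi / 2 < \<alpha> * L" "\<alpha> * L < pi" "tan (\<alpha> * L) = - (\<alpha> / q)"
    using \<alpha> L by (auto simp: hardy_alpha_def L_def[symmetric] q_def field_simps)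
  have \<alpha>0: "0 < \<alpha>"
    using \<alpha>L(1) L pi_gt_zero by (metis less_trans pi_half_gt_zero zero_less_mult_pos2)
  have \<phi>: "0 < \<phi>" "\<phi> < pi / 2" using \<alpha>L by (auto simp: \<phi>_def)
  have cos\<phi>: "0 < cos \<phi>" using \<phi> by (intro cos_gt_zero_pi) auto
  have tan\<phi>: "tan \<phi> = \<alpha> / q"
    using \<alpha>L(3) by (simp add: \<phi>_def tan_def)
  have sec: "1 + (\<alpha> / q)\<^sup>2 = inverse (cos \<phi> ^ 2)"
    unfolding tan\<phi>[symmetric] using cos\<phi> by (subst tan_sec) (auto simp: power_inverse)
  have \<theta>_bd: "0 \<le> \<theta> x" "\<theta> x + \<phi> \<le> pi" if "x \<in> {a..b}" for x
  proof -
    have "0 \<le> ln (x / a)" "ln (x / a) \<le> L" using that ab by (auto simp: L_def divide_right_mono)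
    then show "0 \<le> \<theta> x" "\<theta> x + \<phi> \<le> pi"
      using \<alpha>0 by (auto simp: \<theta>_def \<phi>_def)
  qed
  have \<theta>_ab: "\<theta> a = 0" "\<theta> b + \<phi> = pi"
    using ab by (auto simp: \<theta>_def \<phi>_def L_def)
  have xpos: "0 < x" if "x \<in> {a..b}" for x using that ab by auto
  have \<theta>': "(\<theta> has_real_derivative \<alpha> / x) (at x)" if "x \<in> {a..b}" for x
    unfolding \<theta>_def using xpos[OF that] ab
    by (auto intro!: derivative_eq_intros simp: field_simps)
  have f_eq: "f x = x powr (q - 1) * (sin (\<theta> x + \<phi>) / cos \<phi>)" for x
  proof -
    have e: "- (1 + \<epsilon>) / p = q - 1" using p by (simp add: q_def field_simps)
    have t: "\<alpha> * p / (p - 1 - \<epsilon>) = tan \<phi>" using tan\<phi> by (simp add: q_def)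
    show ?thesis
      unfolding f_def hardy_fstar_def \<theta>_def[symmetric] e t
      using cos\<phi> by (simp add: sin_add tan_def field_simps)
  qed
  have cont\<theta>: "continuous_on {a..b} \<theta>"
    by (rule DERIV_continuous_on) (rule has_field_derivative_at_within[OF \<theta>'])
  have contf: "continuous_on {a..b} f"
  proof -
    have "continuous_on {a..b} (\<lambda>x. x powr (q - 1) * (sin (\<theta> x + \<phi>) / cos \<phi>))"
      using ab cos\<phi> by (intro continuous_intros cont\<theta>) auto
    then show ?thesis by (simp only: f_eq[symmetric])
  qed
  have fnn: "0 \<le> f x" if "x \<in> {a..b}" for x
    unfolding f_eq using \<theta>_bd[OF that] \<phi> cos\<phi>
    by (intro mult_nonneg_nonneg divide_nonneg_pos sin_ge_zero) auto
  obtain S where S: "\<And>t. \<lbrakk>0 \<le> t; t \<le> pi\<rbrakk> \<Longrightarrow> (S has_real_derivative sin t powr p) (at t)"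
    and S_refl: "\<And>t. \<lbrakk>0 \<le> t; t \<le> pi\<rbrakk> \<Longrightarrow> S pi - S t = S (pi - t) - S 0"
    and S_mono: "strict_mono_on {0..pi} S"
    using sin_powr_antiderivative[OF less_trans[OF zero_less_one p]] by blast
  \<comment> \<open>One substitution serves both sides: the shift \<open>\<psi> = \<phi>\<close>
    gives the right side of Hardy's inequality, \<open>\<psi> = 0\<close> the left.\<close>
  have int_sin: "(LINT x:{a<..<b}|lebesgue. C * (sin (\<theta> x + \<psi>) powr p / x)) =
      C * ((S (\<theta> b + \<psi>) - S \<psi>) / \<alpha>)"
    "set_integrable lebesgue {a<..<b} (\<lambda>x. C * (sin (\<theta> x + \<psi>) powr p / x))"
    if \<psi>: "0 \<le> \<psi>" "\<psi> \<le> \<phi>" for C \<psi>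
  proof -
    have rng: "0 \<le> \<theta> x + \<psi>" "\<theta> x + \<psi> \<le> pi" if x: "x \<in> {a..b}" for x
      using \<theta>_bd[OF x] \<psi> by auto
    have D: "((\<lambda>x. C / \<alpha> * S (\<theta> x + \<psi>)) has_real_derivative C * (sin (\<theta> x + \<psi>) powr p / x)) (at x)"
      if x: "x \<in> {a..b}" for x
    proof -
      have "((\<lambda>x. \<theta> x + \<psi>) has_real_derivative \<alpha> / x) (at x)"
        by (rule DERIV_cong[OF DERIV_add[OF \<theta>'[OF x] DERIV_const]]) simp
      from DERIV_cmult[OF DERIV_chain2[OF S[OF rng[OF x]] this], of "C / \<alpha>"]
      show ?thesis using \<alpha>0 by simp
    qed
    have c1: "continuous_on {a..b} (\<lambda>x. sin (\<theta> x + \<psi>))"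
      by (intro continuous_intros cont\<theta>)
    have "continuous_on {a..b} (\<lambda>x. sin (\<theta> x + \<psi>) powr p)"
      by (rule continuous_on_powr'[OF c1 continuous_on_const])
        (use p rng in \<open>auto intro: sin_ge_zero\<close>)
    then have c: "continuous_on {a..b} (\<lambda>x. C * (sin (\<theta> x + \<psi>) powr p / x))"
      using ab by (intro continuous_on_mult continuous_on_divide continuous_on_const continuous_on_id) auto
    show "set_integrable lebesgue {a<..<b} (\<lambda>x. C * (sin (\<theta> x + \<psi>) powr p / x))"
      using ab by (intro set_lebesgue_FTC(1)[OF _ D c]) auto
    show "(LINT x:{a<..<b}|lebesgue. C * (sin (\<theta> x + \<psi>) powr p / x)) =
      C * ((S (\<theta> b + \<psi>) - S \<psi>) / \<alpha>)"
      using ab by (subst set_lebesgue_FTC(2)[OF _ D c]) (auto simp: \<theta>_ab diff_divide_distrib right_diff_distrib)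
  qed
  have rhs_integrand: "f x powr p * x powr \<epsilon> = cos \<phi> powr (- p) * (sin (\<theta> x + \<phi>) powr p / x)"
    if x: "x \<in> {a..b}" for x
  proof -
    have "0 \<le> sin (\<theta> x + \<phi>)" using \<theta>_bd[OF x] \<phi> by (intro sin_ge_zero) auto
    then have "f x powr p * x powr \<epsilon> = (x powr ((q - 1) * p) * x powr \<epsilon>) * (sin (\<theta> x + \<phi>) powr p / cos \<phi> powr p)"
      unfolding f_eq using xpos[OF x] cos\<phi> by (simp add: powr_mult powr_divide powr_powr)
    also have "x powr ((q - 1) * p) * x powr \<epsilon> = 1 / x"
      unfolding powr_add[symmetric] using xpos[OF x] by (simp add: \<epsilon>_eq algebra_simps powr_minus_divide)
    finally show ?thesis by (simp add: powr_minus_divide)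
  qed
  have "hardy_rhs a b p \<epsilon> f = (LINT x:{a<..<b}|lebesgue. cos \<phi> powr (- p) * (sin (\<theta> x + \<phi>) powr p / x))"
    unfolding hardy_rhs_def by (rule set_lebesgue_integral_cong) (use rhs_integrand in auto)
  also have "\<dots> = cos \<phi> powr (- p) * ((S pi - S \<phi>) / \<alpha>)"
    using \<phi> by (subst int_sin(1)) (auto simp: \<theta>_ab)
  finally have rhs: "hardy_rhs a b p \<epsilon> f = cos \<phi> powr (- p) * ((S pi - S \<phi>) / \<alpha>)" .
  have primitive: "(LINT t:{a<..<x}|lebesgue. f t) = x powr q * sin (\<theta> x) / q" if x: "x \<in> {a<..<b}" for x
  proof -
    have "(LINT t:{a<..<x}|lebesgue. f t) = x powr q * sin (\<theta> x) / q - a powr q * sin (\<theta> a) / q"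
    proof (rule set_lebesgue_FTC(2)[where F = "\<lambda>x. x powr q * sin (\<theta> x) / q"])
      show "continuous_on {a..x} f" using x by (intro continuous_on_subset[OF contf]) auto
      fix t assume "t \<in> {a..x}"
      then have t: "t \<in> {a..b}" using x by auto
      have "f t = t powr (q - 1) * (sin (\<theta> t) + \<alpha> / q * cos (\<theta> t))"
        unfolding f_eq tan\<phi>[symmetric] using cos\<phi> by (simp add: sin_add tan_def field_simps)
      then show "((\<lambda>x. x powr q * sin (\<theta> x) / q) has_real_derivative f t) (at t)"
        using xpos[OF t] q
        by (auto intro!: derivative_eq_intros \<theta>'[OF t] simp: powr_diff field_simps)
    qed (use x in auto)
    then show ?thesis by (simp add: \<theta>_ab)
  qed
  have lhs_integrand: "(1 / x * (LINT t:{a<..<x}|lebesgue. f t)) powr p * x powr \<epsilon> =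
      q powr (- p) * (sin (\<theta> x + 0) powr p / x)" if x: "x \<in> {a<..<b}" for x
  proof -
    have x': "x \<in> {a..b}" using x by auto
    have "0 \<le> sin (\<theta> x)" using \<theta>_bd[OF x'] \<phi> by (intro sin_ge_zero) auto
    moreover have "1 / x * (LINT t:{a<..<x}|lebesgue. f t) = x powr (q - 1) * sin (\<theta> x) / q"
      using primitive[OF x] xpos[OF x'] by (simp add: powr_diff)
    ultimately have "(1 / x * (LINT t:{a<..<x}|lebesgue. f t)) powr p * x powr \<epsilon> =
      (x powr ((q - 1) * p) * x powr \<epsilon>) * (sin (\<theta> x) powr p / q powr p)"
      using xpos[OF x'] q by (simp add: powr_mult powr_divide powr_powr)
    also have "x powr ((q - 1) * p) * x powr \<epsilon> = 1 / x"
      unfolding powr_add[symmetric] using xpos[OF x'] by (simp add: \<epsilon>_eq algebra_simps powr_minus_divide)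
    finally show ?thesis by (simp add: powr_minus_divide)
  qed
  have "hardy_lhs a b p \<epsilon> f = (LINT x:{a<..<b}|lebesgue. q powr (- p) * (sin (\<theta> x + 0) powr p / x))"
    unfolding hardy_lhs_def by (rule set_lebesgue_integral_cong) (use lhs_integrand in auto)
  also have "\<dots> = q powr (- p) * ((S (\<theta> b + 0) - S 0) / \<alpha>)"
    using \<phi> by (intro int_sin) auto
  also have "S (\<theta> b + 0) - S 0 = S pi - S \<phi>"
  proof -
    have "\<theta> b + 0 = pi - \<phi>" using \<theta>_ab(2) by simp
    then show ?thesis using S_refl[of \<phi>] \<phi> by simp
  qed
  finally have lhs: "hardy_lhs a b p \<epsilon> f = q powr (- p) * ((S pi - S \<phi>) / \<alpha>)" .
  show "0 < hardy_rhs a b p \<epsilon> (hardy_fstar a p \<epsilon> \<alpha>)"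
    unfolding f_def[symmetric] rhs using cos\<phi> \<alpha>0 \<phi> strict_mono_onD[OF S_mono, of \<phi> pi]
    by (auto intro!: mult_pos_pos divide_pos_pos)
  have "(1 + (\<alpha> / q)\<^sup>2) powr (p / 2) = cos \<phi> powr (- p)"
  proof -
    have "1 + (\<alpha> / q)\<^sup>2 = cos \<phi> powr (- 2)"
      unfolding sec using cos\<phi> by (simp add: powr_minus powr_numeral)
    then show ?thesis by (simp add: powr_powr)
  qed
  then show "q powr p * (1 + (\<alpha> / q)\<^sup>2) powr (p / 2) * hardy_lhs a b p \<epsilon> (hardy_fstar a p \<epsilon> \<alpha>) =
      hardy_rhs a b p \<epsilon> (hardy_fstar a p \<epsilon> \<alpha>)"
    unfolding f_def[symmetric] rhs lhs using q by (simp add: powr_minus)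
  show "hardy_admissible a b p \<epsilon> (hardy_fstar a p \<epsilon> \<alpha>)"
    unfolding hardy_admissible_def f_def[symmetric]
  proof (intro conjI ballI)
    have "set_integrable lebesgue {a<..<b} f"
      using absolutely_integrable_continuous_real[OF contf] by (rule set_integrable_subset) auto
    then show "set_borel_measurable lebesgue {a<..<b} f"
      by (auto simp: set_integrable_def set_borel_measurable_def)
    show "0 \<le> f x" if "x \<in> {a<..<b}" for x using that fnn by auto
    have "set_integrable lebesgue {a<..<b} (\<lambda>x. f x powr p * x powr \<epsilon>) \<longleftrightarrow>
      set_integrable lebesgue {a<..<b} (\<lambda>x. cos \<phi> powr (- p) * (sin (\<theta> x + \<phi>) powr p / x))"
      by (rule set_integrable_cong) (use rhs_integrand in auto)
    then show "set_integrable lebesgue {a<..<b} (\<lambda>x. f x powr p * x powr \<epsilon>)"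
      using int_sin(2) \<phi> by auto
  qed
qed

section \<open>Attainment of the best constant\<close>

text \<open>A \<open>LEAST\<close> on the reals can be bounded only once a minimum exists. The
  infimum is itself a valid constant because, for each fixed function, the inequality is a closed
  condition on \<open>d\<close>. The valid constants include \<open>D\<close>, and the test function
  \<open>f\<close>, whose right side is positive, bounds them below by \<open>m\<close>.\<close>

lemma hardy_constant_between:
  assumes D: "hardy_inequality a b p \<epsilon> D"
    and f: "hardy_admissible a b p \<epsilon> f" "0 < hardy_rhs a b p \<epsilon> f"
    and m: "m * hardy_rhs a b p \<epsilon> f \<le> hardy_lhs a b p \<epsilon> f"
  shows "m \<le> hardy_constant a b p \<epsilon>" "hardy_constant a b p \<epsilon> \<le> D"
proof -
  define d0 where "d0 = Inf {d. hardy_inequality a b p \<epsilon> d}"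
  have ge: "m \<le> d" if "hardy_inequality a b p \<epsilon> d" for d
  proof -
    have "m * hardy_rhs a b p \<epsilon> f \<le> d * hardy_rhs a b p \<epsilon> f"
      using that f(1) m by (force simp: hardy_inequality_def)
    then show ?thesis using f(2) by simp
  qed
  have bdd: "bdd_below {d. hardy_inequality a b p \<epsilon> d}"
    using ge by (auto simp: bdd_below_def)
  have "hardy_inequality a b p \<epsilon> d0"
    unfolding hardy_inequality_def
  proof (intro allI impI)
    fix h assume h: "hardy_admissible a b p \<epsilon> h"
    have le: "hardy_lhs a b p \<epsilon> h \<le> d * hardy_rhs a b p \<epsilon> h" if "hardy_inequality a b p \<epsilon> d" for d
      using that h by (auto simp: hardy_inequality_def)
    have "0 \<le> hardy_rhs a b p \<epsilon> h"
      unfolding hardy_rhs_def set_lebesgue_integral_def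
      by (intro Bochner_Integration.integral_nonneg) (auto simp: indicator_def)
    then consider "hardy_rhs a b p \<epsilon> h = 0" | "0 < hardy_rhs a b p \<epsilon> h" by linarith
    then show "hardy_lhs a b p \<epsilon> h \<le> d0 * hardy_rhs a b p \<epsilon> h"
    proof cases
      case 1
      \<comment> \<open>With right side zero, every constant gives the same condition, and the
        validity of \<open>D\<close> supplies it.\<close>
      then show ?thesis using le[OF D] by simp
    next
      case 2
      then have "hardy_lhs a b p \<epsilon> h / hardy_rhs a b p \<epsilon> h \<le> d0"
        unfolding d0_def using D le by (intro cInf_greatest) (auto simp: pos_divide_le_eq)
      then show ?thesis using 2 by (simp add: pos_divide_le_eq)
    qed
  qed
  moreover have "d0 \<le> d" if "hardy_inequality a b p \<epsilon> d" for d
    unfolding d0_def using that by (intro cInf_lower bdd) auto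
  ultimately have eq: "hardy_constant a b p \<epsilon> = d0"
    unfolding hardy_constant_def by (rule Least_equality)
  show "m \<le> hardy_constant a b p \<epsilon>"
    unfolding eq by (rule ge) fact
  show "hardy_constant a b p \<epsilon> \<le> D"
    unfolding eq by (rule \<open>\<And>d. hardy_inequality a b p \<epsilon> d \<Longrightarrow> d0 \<le> d\<close>) (rule D)
qed

section \<open>Explicit constants and conclusion\<close>

text \<open>The power is at most \<open>exp (r * s)\<close>; then
  \<open>exp x \<le> 1 + x * exp x\<close>, a form of \<open>1 - x \<le> exp (- x)\<close>, is used
  at \<open>x = r * s \<le> r\<close>.\<close>

lemma one_add_powr_le_linear:
  fixes s r :: real
  assumes "0 \<le> s" "s \<le> 1" "0 \<le> r"
  shows "(1 + s) powr r \<le> 1 + r * exp r * s"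
proof -
  have "(1 + s) powr r = exp (r * ln (1 + s))"
    using assms by (simp add: powr_def)
  also have "\<dots> \<le> exp (r * s)"
    using assms by (auto intro!: mult_left_mono ln_add_one_self_le_self)
  also have "\<dots> \<le> 1 + r * s * exp (r * s)"
  proof -
    have "(1 - r * s) * exp (r * s) \<le> exp (- (r * s)) * exp (r * s)"
      using exp_ge_add_one_self[of "- (r * s)"] by (intro mult_right_mono) auto
    then show ?thesis by (simp add: exp_minus algebra_simps)
  qed
  also have "\<dots> \<le> 1 + r * s * exp r"
    using assms by (auto intro!: mult_left_mono mult_left_le)
  finally show ?thesis by (simp add: ac_simps)
qed

theorem theorem1p2:
  fixes p \<epsilon> :: real
  assumes "2 \<le> p" and "\<epsilon> < p - 1"
  shows "\<exists>c1 c2 :: real. c1 > 0 \<and> c2 > 0 \<and>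
    (\<forall>a b :: real. 0 < a \<longrightarrow> a < b \<longrightarrow> b / a > hardy_b0 p \<epsilon> \<longrightarrow>
      ((p / (p - 1 - \<epsilon>)) powr p * inverse (1 + c1 / (ln (b / a))\<^sup>2) \<le> hardy_constant a b p \<epsilon> \<and>
       hardy_constant a b p \<epsilon> \<le> (p / (p - 1 - \<epsilon>)) powr p * inverse (1 + c2 / (ln (b / a))\<^sup>2)) \<and>
      (\<exists>!\<alpha>. hardy_alpha a b p \<epsilon> \<alpha>) \<and>
      (\<forall>\<alpha>. hardy_alpha a b p \<epsilon> \<alpha> \<longrightarrow>
         hardy_lhs a b p \<epsilon> (hardy_fstar a p \<epsilon> \<alpha>)
           \<ge> (p / (p - 1 - \<epsilon>)) powr p * inverse (1 + c1 / (ln (b / a))\<^sup>2)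
              * hardy_rhs a b p \<epsilon> (hardy_fstar a p \<epsilon> \<alpha>)))"
proof -
  define q where "q = (p - 1 - \<epsilon>) / p"
  \<comment> \<open>With \<open>\<alpha> \<le> pi / L\<close>, this is the coefficient of
    \<open>1 / L\<^sup>2\<close> in the linear bound for
    \<open>(1 + (\<alpha> / q)\<^sup>2) powr (p / 2)\<close>.\<close>
  define c1 where "c1 = p / 2 * exp (p / 2) * (pi / q)\<^sup>2"
  define A where "A = (p - 1) / q * (1 / 2) powr (p - 2)"
  define C where "C = p * (p - 1) * 2 powr p"
  \<comment> \<open>The surplus \<open>2 * \<eta> * A / L - C * \<eta>\<^sup>2\<close> has maximum
    \<open>c2 / L\<^sup>2\<close>, reached at \<open>\<eta> = A / (C * L)\<close>.\<close>
  define c2 where "c2 = A\<^sup>2 / C"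
  have q: "0 < q" using assms by (simp add: q_def)
  have A: "0 < A" using assms q by (simp add: A_def)
  have C: "2 \<le> C"
  proof -
    have "2 * 1 * 1 \<le> p * (p - 1) * 2 powr p"
      using assms ge_one_powr_ge_zero[of 2 p] by (intro mult_mono) auto
    then show ?thesis by (simp add: C_def)
  qed
  have K: "(p / (p - 1 - \<epsilon>)) powr p = inverse (q powr p)"
    using assms by (simp add: q_def powr_divide)
  have c1: "0 < c1" using assms q by (simp add: c1_def)
  have c2: "0 < c2" using A C by (simp add: c2_def)
  show ?thesis
  proof (rule exI[of _ c1], rule exI[of _ c2], intro conjI c1 c2 allI impI)
    fix a b :: real
    assume ab: "0 < a" "a < b" and b0: "hardy_b0 p \<epsilon> < b / a"
    define L where "L = ln (b / a)"
    \<comment> \<open>The threshold enters through two consequences: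
      \<open>(p - 1) / q \<le> L\<close>, which together with \<open>2 \<le> C\<close> makes
      \<open>\<eta>\<close> at most \<open>1 / 2\<close>, and \<open>pi / q \<le> L\<close>, which
      makes \<open>(\<alpha> / q)\<^sup>2\<close> at most \<open>1\<close>, as the linear bound
      requires.\<close>
    have "ln (hardy_b0 p \<epsilon>) < L"
      unfolding L_def using b0 by (subst ln_less_cancel_iff) (use ab in \<open>auto simp: hardy_b0_def\<close>)
    moreover have "ln (hardy_b0 p \<epsilon>) = sqrt 2 * pi * ((p - 1) / q)"
      using assms by (simp add: hardy_b0_def q_def)
    moreover have "pi * ((p - 1) / q) \<le> sqrt 2 * pi * ((p - 1) / q)"
      using assms q by (intro mult_right_mono) auto
    ultimately have L_gt: "pi * ((p - 1) / q) < L" by simp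
    have "1 * ((p - 1) / q) \<le> pi * ((p - 1) / q)"
      using assms q pi_ge_two by (intro mult_right_mono) auto
    with L_gt have L_ge: "(p - 1) / q \<le> L" by simp
    have L: "0 < L" using ab by (simp add: L_def)
    have "pi * (1 / q) \<le> pi * ((p - 1) / q)"
      using assms q by (intro mult_left_mono divide_right_mono) auto
    with L_gt have "pi / q \<le> 1 * L" by simp
    then have qL: "pi / q / L \<le> 1" by (simp only: pos_divide_le_eq[OF L])
    have upper: "hardy_inequality a b p \<epsilon> (inverse (q powr p * (1 + c2 / L\<^sup>2)))"
    proof (rule hardy_inequality_linear_profile[where \<eta> = "A / (C * L)"])
      have "(1 / 2) powr (p - 2) \<le> (1 / 2 :: real) powr 0"
        using assms by (intro powr_mono') auto
      then have "A \<le> (p - 1) / q * 1"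
        unfolding A_def using assms q by (intro mult_left_mono) auto
      then have "2 * A \<le> C * L"
        using L_ge C L A by (intro mult_mono) auto
      then show "A / (C * L) \<le> 1 / 2"
        using C L by (simp add: field_simps)
      have "c2 / L\<^sup>2 + C * (A / (C * L))\<^sup>2 = 2 * (A / (C * L)) / L * A"
        using C L by (simp add: c2_def field_simps power2_eq_square)
      then show "c2 / L\<^sup>2 + p * (p - 1) * 2 powr p * (A / (C * L))\<^sup>2 \<le>
          2 * (A / (C * L)) / ln (b / a) * ((p - 1) / q * (1 / 2) powr (p - 2))"
        by (simp only: C_def[symmetric] A_def[symmetric] L_def[symmetric])
      show "0 < A / (C * L)" using A C L by simp
    qed (use assms ab q_def c2 in auto)
    \<comment> \<open>For every root \<open>\<alpha>\<close> this is claim (ii); at the existing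
      root it also bounds the least constant from below, so both claims share
      \<open>c1\<close>.\<close>
    have lower: "inverse (q powr p) * inverse (1 + c1 / L\<^sup>2) * hardy_rhs a b p \<epsilon> (hardy_fstar a p \<epsilon> \<alpha>)
        \<le> hardy_lhs a b p \<epsilon> (hardy_fstar a p \<epsilon> \<alpha>)" if \<alpha>: "hardy_alpha a b p \<epsilon> \<alpha>" for \<alpha>
    proof -
      let ?l = "hardy_lhs a b p \<epsilon> (hardy_fstar a p \<epsilon> \<alpha>)"
      let ?r = "hardy_rhs a b p \<epsilon> (hardy_fstar a p \<epsilon> \<alpha>)"
      define T where "T = (1 + (\<alpha> / q)\<^sup>2) powr (p / 2)"
      have r: "q powr p * T * ?l = ?r"
        using hardy_fstar_extremal(3)[OF ab _ assms(2) q_def \<alpha>] assms by (auto simp: T_def)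
      have l: "0 \<le> ?l"
        unfolding hardy_lhs_def set_lebesgue_integral_def
        by (intro Bochner_Integration.integral_nonneg) (auto simp: indicator_def)
      have "pi / 2 / L < \<alpha>" "\<alpha> < pi / L"
        using \<alpha> by (auto simp: hardy_alpha_def L_def)
      moreover have "0 < pi / 2 / L" using L by simp
      ultimately have \<alpha>_bd: "0 \<le> \<alpha>" "\<alpha> \<le> pi / L" by linarith+
      then have "\<alpha> / q \<le> pi / L / q"
        using q by (intro divide_right_mono) auto
      with \<alpha>_bd q have "0 \<le> \<alpha> / q" "\<alpha> / q \<le> pi / q / L"
        by (simp_all add: mult.commute)
      then have s: "(\<alpha> / q)\<^sup>2 \<le> (pi / q / L)\<^sup>2" "(\<alpha> / q)\<^sup>2 \<le> 1"
        using qL by (auto intro: power_mono power_le_one)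
      have "T \<le> 1 + p / 2 * exp (p / 2) * (\<alpha> / q)\<^sup>2"
        unfolding T_def using s assms by (intro one_add_powr_le_linear) auto
      also have "\<dots> \<le> 1 + p / 2 * exp (p / 2) * (pi / q / L)\<^sup>2"
        using s assms by (intro add_left_mono mult_left_mono) auto
      also have "\<dots> = 1 + c1 / L\<^sup>2"
        by (simp add: c1_def power_divide power_mult_distrib)
      finally have T: "T \<le> 1 + c1 / L\<^sup>2" .
      have pos: "0 < 1 + c1 / L\<^sup>2" using c1 by (simp add: add_pos_nonneg)
      have "inverse (q powr p) * inverse (1 + c1 / L\<^sup>2) * ?r = T / (1 + c1 / L\<^sup>2) * ?l"
        unfolding r[symmetric] using q by (simp add: divide_inverse)
      also have "\<dots> \<le> 1 * ?l"
        using T pos l by (intro mult_right_mono) auto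
      finally show ?thesis by simp
    qed
    have ex1: "\<exists>!\<alpha>. hardy_alpha a b p \<epsilon> \<alpha>"
      using tan_add_linear_ex1[OF L, of "p / (p - 1 - \<epsilon>)"] assms
      by (simp add: hardy_alpha_def L_def)
    then obtain \<alpha> where \<alpha>: "hardy_alpha a b p \<epsilon> \<alpha>" by blast
    have p1: "1 < p" using assms by simp
    note bounds = hardy_constant_between[OF upper hardy_fstar_extremal(1,2)[OF ab p1 assms(2) q_def \<alpha>] lower[OF \<alpha>]]
    show "(p / (p - 1 - \<epsilon>)) powr p * inverse (1 + c1 / (ln (b / a))\<^sup>2) \<le> hardy_constant a b p \<epsilon>"
      using bounds(1) unfolding K L_def .
    show "hardy_constant a b p \<epsilon> \<le> (p / (p - 1 - \<epsilon>)) powr p * inverse (1 + c2 / (ln (b / a))\<^sup>2)"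
      using bounds(2) unfolding K L_def by simp
    show "\<exists>!\<alpha>. hardy_alpha a b p \<epsilon> \<alpha>" by (rule ex1)
    show "(p / (p - 1 - \<epsilon>)) powr p * inverse (1 + c1 / (ln (b / a))\<^sup>2) *
        hardy_rhs a b p \<epsilon> (hardy_fstar a p \<epsilon> \<alpha>) \<le> hardy_lhs a b p \<epsilon> (hardy_fstar a p \<epsilon> \<alpha>)"
      if "hardy_alpha a b p \<epsilon> \<alpha>" for \<alpha>
      using lower[OF that] unfolding K L_def .
  qed
qed

end
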